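(* For all $1\le i\le r-1$ and all $f\in\Lambda(X_1|\cdots|X_r)$, $$D_i\big(f(X_1|\cdots|X_r)\big)=\langle z^0\rangle\, f(X_1|\cdots|X_i+z|X_{i+1}-z^{-1}|\cdots|X_r)\,\Omega(zX_{i+1}).$$
   Context: $\Lambda(X_1|\cdots|X_r)=\Lambda(X_1)\otimes\cdots\otimes\Lambda(X_r)$ over $\mathbb{Q}$, $X_i=\{x_{i,1},x_{i,2},\dots\}$. For variables $x,y$, $\xi_{x,y}(g)=\frac{xg(x,y)-yg(y,x)}{x-y}$; $\xi^{(i)}_j=\xi_{x_{i,j},x_{i,j+1}}$. $\langle z^a\rangle$ extracts the coefficient of $z^a$. For $f\in\Lambda(X_1|\cdots|X_r)$ and $n_1,\dots,n_r\ge1$, let $f(X_1^{(n_1)}|\cdots|X_i^{(n_i)}+z|\cdots|X_r^{(n_r)})$ denote $f$ with $X_j$ specialized to $x_{j,1},\dots,x_{j,n_j}$ (other variables $0$) for $j\ne i$ and $X_i$ specialized to $x_{i,1},\dots,x_{i,n_i},z$; set $D_i^{(n_1|\cdots|n_r)}(f)=\langle z^0\rangle\,\xi^{(i+1)}_{n_{i+1}-1}\cdots\xi^{(i+1)}_1\xi_{z,x_{i+1,1}}\big(f(X_1^{(n_1)}|\cdots|X_i^{(n_i)}+z|\cdots|X_r^{(n_r)})\big)$, and $D_i(f)=\lim_{n_1,\dots,n_r\to\infty}D_i^{(n_1|\cdots|n_r)}(f)$ (coefficientwise limit, which exists and lies in $\Lambda(X_1|\cdots|X_r)$). Plethystic notation: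 $f(\dots|X_i+z|\dots)$ means adding $z$ as an extra variable to $X_i$; $f(\dots|X_{i+1}-z^{-1}|\dots)$ is the plethystic substitution determined by $p_k(X_{i+1})\mapsto p_k(X_{i+1})-z^{-k}$ on power sums; $\Omega(zX)=\sum_{\lambda}z^{|\lambda|}m_\lambda(X)=\sum_{n\ge0}z^nh_n(X)$.
   Formalization: The formula is proved with X_i+z^{-1} in place of X_i+z; as printed it fails for r=2, i=1, f=p_1(X_1), where D_1(f)=p_1(X_1)+p_1(X_2) but the printed right side is p_1(X_1). *)

theory Defs
  imports
    "HOL-Computational_Algebra.Formal_Laurent_Series"
    "HOL-Library.Poly_Mapping"
    "HOL-Combinatorics.Permutations"
begin

section \<open>Formal power series in arbitrarily many variables\<close>

text \<open>
  Monomials are finitely supported exponent vectors. A series is an arbitrary family of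
  coefficients; the product is the Cauchy product, which is a finite sum for every monomial.
\<close>

typedef ('v, 'a) mseries = "UNIV :: (('v \<Rightarrow>\<^sub>0 nat) \<Rightarrow> 'a) set"
  morphisms coeff MSeries ..

lemma coeff_MSeries [simp]: "coeff (MSeries f) = f"
  by (simp add: MSeries_inverse)

lemma mseries_eqI: "(\<And>m. coeff f m = coeff g m) \<Longrightarrow> f = g"
  by (metis coeff_inject ext)

definition splits :: "('v \<Rightarrow>\<^sub>0 nat) \<Rightarrow> (('v \<Rightarrow>\<^sub>0 nat) \<times> ('v \<Rightarrow>\<^sub>0 nat)) set" where
  "splits m = {(a, b). a + b = m}"

lemma finite_splits [simp]: "finite (splits (m :: 'v \<Rightarrow>\<^sub>0 nat))"
proof -
  let ?K = "Poly_Mapping.keys m" and ?l = "Poly_Mapping.lookup :: ('v \<Rightarrow>\<^sub>0 nat) \<Rightarrow> _"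
  let ?A = "fst ` splits m"
  have le: "?l a v \<le> ?l m v" if "a \<in> ?A" for a v
    using that by (auto simp: splits_def lookup_add)
  have out: "?l a v = 0" if "a \<in> ?A" "v \<notin> ?K" for a v
    using le[OF that(1), of v] that(2) by (simp add: in_keys_iff)
  have inj: "inj_on (\<lambda>a. restrict (?l a) ?K) ?A"
  proof (rule inj_onI)
    fix a b assume a: "a \<in> ?A" and b: "b \<in> ?A" and eq: "restrict (?l a) ?K = restrict (?l b) ?K"
    show "a = b"
    proof (rule poly_mapping_eqI)
      fix v show "?l a v = ?l b v"
        using out[OF a, of v] out[OF b, of v] fun_cong[OF eq, of v] by (cases "v \<in> ?K") auto
    qed
  qed
  have "(\<lambda>a. restrict (?l a) ?K) ` ?A \<subseteq> (\<Pi>\<^sub>E v\<in>?K. {..?l m v})"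
    by (rule image_subsetI) (simp add: PiE_iff le)
  moreover have "finite (\<Pi>\<^sub>E v\<in>?K. {..?l m v})"
    by (intro finite_PiE) auto
  ultimately have fA: "finite ?A"
    using inj finite_imageD finite_subset by blast
  have "splits m \<subseteq> (\<lambda>a. (a, m - a)) ` ?A"
    by (force simp: splits_def image_iff)
  with fA show ?thesis
    using finite_subset by blast
qed

instantiation mseries :: (type, comm_ring_1) comm_ring_1
begin

definition "0 = MSeries (\<lambda>m. 0)"
definition "1 = MSeries (\<lambda>m. if m = 0 then 1 else 0)"
definition "f + g = MSeries (\<lambda>m. coeff f m + coeff g m)"
definition "f - g = MSeries (\<lambda>m. coeff f m - coeff g m)"
definition "- f = MSeries (\<lambda>m. - coeff f m)"
definition "f * g = MSeries (\<lambda>m. \<Sum>(a, b)\<in>splits m. coeff f a * coeff g b)"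

instance
proof
  fix f g h :: "('a, 'b) mseries"
  show "f * g * h = f * (g * h)"
  proof (rule mseries_eqI)
    fix m :: "'a \<Rightarrow>\<^sub>0 nat"
    have "coeff (f * g * h) m =
        (\<Sum>(p, c)\<in>splits m. \<Sum>(a, b)\<in>splits p. coeff f a * coeff g b * coeff h c)"
      by (simp add: times_mseries_def case_prod_unfold sum_distrib_right)
    also have "\<dots> = (\<Sum>((p, c), (a, b))\<in>(SIGMA x:splits m. splits (fst x)).
        coeff f a * coeff g b * coeff h c)"
      by (simp add: sum.Sigma case_prod_unfold)
    also have "\<dots> = (\<Sum>((a, q), (b, c))\<in>(SIGMA x:splits m. splits (snd x)).
        coeff f a * coeff g b * coeff h c)"
      by (rule sum.reindex_bij_witness[of _
            "\<lambda>((a, q), (b, c)). ((a + b, c), (a, b))" "\<lambda>((p, c), (a, b)). ((a, b + c), (b, c))"])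
        (auto simp: splits_def add.assoc)
    also have "\<dots> = (\<Sum>(a, q)\<in>splits m. \<Sum>(b, c)\<in>splits q. coeff f a * coeff g b * coeff h c)"
      by (simp add: sum.Sigma case_prod_unfold)
    also have "\<dots> = coeff (f * (g * h)) m"
      by (simp add: times_mseries_def case_prod_unfold sum_distrib_left mult.assoc)
    finally show "coeff (f * g * h) m = coeff (f * (g * h)) m" .
  qed
  show "f * g = g * f"
  proof (rule mseries_eqI)
    fix m :: "'a \<Rightarrow>\<^sub>0 nat"
    show "coeff (f * g) m = coeff (g * f) m"
      unfolding times_mseries_def coeff_MSeries
      by (rule sum.reindex_bij_witness[of _ prod.swap prod.swap])
        (auto simp: splits_def add.commute mult.commute)
  qed
  show "1 * f = f"
  proof (rule mseries_eqI)
    fix m :: "'a \<Rightarrow>\<^sub>0 nat"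
    have "coeff (1 * f) m = (\<Sum>(a, b)\<in>splits m. (if a = 0 then 1 else 0) * coeff f b)"
      by (simp add: times_mseries_def one_mseries_def)
    also have "\<dots> = (\<Sum>(a, b)\<in>{(0 :: 'a \<Rightarrow>\<^sub>0 nat, m)}. (if a = 0 then 1 else 0) * coeff f b)"
      by (rule sum.mono_neutral_right[OF finite_splits]) (auto simp: splits_def split: if_splits)
    finally show "coeff (1 * f) m = coeff f m" by simp
  qed
  show "(f + g) * h = f * h + g * h"
    by (rule mseries_eqI)
      (simp add: times_mseries_def plus_mseries_def case_prod_unfold distrib_right sum.distrib)
  show "(0 :: ('a, 'b) mseries) \<noteq> 1"
  proof
    assume "(0 :: ('a, 'b) mseries) = 1"
    then have "coeff (0 :: ('a, 'b) mseries) 0 = coeff 1 0" by simp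
    then show False by (simp add: zero_mseries_def one_mseries_def)
  qed
qed (auto intro!: mseries_eqI simp: plus_mseries_def minus_mseries_def uminus_mseries_def
      zero_mseries_def algebra_simps)

end

definition const :: "'a \<Rightarrow> ('v, 'a :: comm_ring_1) mseries" where
  "const c = MSeries (\<lambda>m. if m = 0 then c else 0)"

definition variable :: "'v \<Rightarrow> ('v, 'a :: comm_ring_1) mseries" where
  "variable v = MSeries (\<lambda>m. if m = Poly_Mapping.single v 1 then 1 else 0)"

definition total_degree :: "('v \<Rightarrow>\<^sub>0 nat) \<Rightarrow> nat" where
  "total_degree m = (\<Sum>v\<in>Poly_Mapping.keys m. Poly_Mapping.lookup m v)"

text \<open>
  The series obtained by replacing every variable \<open>v\<close> by \<open>\<pi> v\<close>, for a bijection \<open>\<pi>\<close>: the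
  coefficient at \<open>m\<close> is the old coefficient at the exponent vector \<open>m \<circ> \<pi>\<close>.
\<close>

definition rename :: "('v \<Rightarrow> 'v) \<Rightarrow> ('v, 'a) mseries \<Rightarrow> ('v, 'a) mseries" where
  "rename \<pi> f = MSeries (\<lambda>m. coeff f (Poly_Mapping.map_key \<pi> m))"

definition swap_vars :: "'v \<Rightarrow> 'v \<Rightarrow> ('v, 'a) mseries \<Rightarrow> ('v, 'a) mseries" where
  "swap_vars x y = rename (transpose x y)"

definition set_zero :: "'v set \<Rightarrow> ('v, 'a :: comm_ring_1) mseries \<Rightarrow> ('v, 'a) mseries" where
  "set_zero S f = MSeries (\<lambda>m. if Poly_Mapping.keys m \<inter> S = {} then coeff f m else 0)"

text \<open>The coefficient of \<open>x\<^sup>a\<close>, a series in the remaining variables.\<close>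

definition coeff_of_power :: "'v \<Rightarrow> nat \<Rightarrow> ('v, 'a :: comm_ring_1) mseries \<Rightarrow> ('v, 'a) mseries" where
  "coeff_of_power x a f =
     MSeries (\<lambda>m. if x \<in> Poly_Mapping.keys m then 0 else coeff f (m + Poly_Mapping.single x a))"

section \<open>The ring of multi-symmetric functions\<close>

text \<open>
  \<open>X i j\<close> is the variable \<open>x\<^bsub>i,j\<^esub>\<close>; as on paper, the indices that matter start at 1.
\<close>

datatype var = Z | X nat nat

type_synonym series = "(var, rat) mseries"

definition alphabet :: "nat \<Rightarrow> var set" where
  "alphabet i = {X i j | j. 1 \<le> j}"

definition Sym :: "nat \<Rightarrow> series set" where
  "Sym i = {f.
     (\<forall>m. coeff f m \<noteq> 0 \<longrightarrow> Poly_Mapping.keys m \<subseteq> alphabet i) \<and>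
     (\<exists>d. \<forall>m. coeff f m \<noteq> 0 \<longrightarrow> total_degree m \<le> d) \<and>
     (\<forall>\<pi>. \<pi> permutes alphabet i \<longrightarrow> rename \<pi> f = f)}"

text \<open>
  The tensor product of the rings \<open>Sym 1, \<dots>, Sym r\<close>, realised inside the power series: as the
  alphabets are disjoint, multiplication identifies it with the set of finite sums of products
  \<open>g\<^sub>1(X\<^sub>1) \<cdots> g\<^sub>r(X\<^sub>r)\<close>. (For \<open>r \<ge> 1\<close> this set is closed under scalars; only \<open>r \<ge> 2\<close> is used.)
\<close>

definition Lambda :: "nat \<Rightarrow> series set" where
  "Lambda r = {\<Sum>k<N. \<Prod>i=1..r. g k i | (N :: nat) g. \<forall>k<N. \<forall>i\<in>{1..r}. g k i \<in> Sym i}"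

definition power_sum :: "nat \<Rightarrow> nat \<Rightarrow> series" where
  "power_sum i k = MSeries (\<lambda>m. if \<exists>v\<in>alphabet i. m = Poly_Mapping.single v k then 1 else 0)"

definition complete_homogeneous :: "nat \<Rightarrow> nat \<Rightarrow> series" where
  "complete_homogeneous i n =
     MSeries (\<lambda>m. if Poly_Mapping.keys m \<subseteq> alphabet i \<and> total_degree m = n then 1 else 0)"

section \<open>The operators \<open>D\<^sub>i\<close>\<close>

text \<open>The quotient is unique, since \<open>x - y\<close> is not a zero divisor for distinct \<open>x\<close>, \<open>y\<close>.\<close>

definition xi :: "var \<Rightarrow> var \<Rightarrow> series \<Rightarrow> series" where
  "xi x y g = (THE q. (variable x - variable y) * q =
                        variable x * g - variable y * swap_vars x y g)"

text \<open>
  \<open>X\<^sub>i\<close> is specialised to \<open>x\<^bsub>i,1\<^esub>, \<dots>, x\<^bsub>i,n i\<^esub>, z\<close> by letting \<open>z\<close> take the place of the variable with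
  index \<open>n i + 1\<close> (by symmetry the place is immaterial); the swap is a plain renaming because
  elements of \<open>Lambda r\<close> do not involve \<open>Z\<close>.
\<close>

definition specialise :: "nat \<Rightarrow> (nat \<Rightarrow> nat) \<Rightarrow> series \<Rightarrow> series" where
  "specialise i n f = set_zero {X j k | j k. n j < k} (swap_vars Z (X i (n i + 1)) f)"

definition D_fin :: "nat \<Rightarrow> (nat \<Rightarrow> nat) \<Rightarrow> series \<Rightarrow> series" where
  "D_fin i n f =
     coeff_of_power Z 0
       (fold (\<lambda>j. xi (X (i + 1) j) (X (i + 1) (j + 1))) [1..<n (i + 1)]
         (xi Z (X (i + 1) 1) (specialise i n f)))"

definition coeffwise_limit :: "nat \<Rightarrow> ((nat \<Rightarrow> nat) \<Rightarrow> series) \<Rightarrow> series \<Rightarrow> bool" where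
  "coeffwise_limit r F L \<longleftrightarrow>
     (\<forall>m. \<exists>N. \<forall>n. (\<forall>j\<in>{1..r}. N \<le> n j) \<longrightarrow> coeff (F n) m = coeff L m)"

definition D :: "nat \<Rightarrow> nat \<Rightarrow> series \<Rightarrow> series" where
  "D r i f = (THE L. coeffwise_limit r (\<lambda>n. D_fin i n f) L)"

section \<open>Plethystic substitution\<close>

text \<open>Polynomials with rational coefficients in indeterminates indexed by pairs.\<close>

type_synonym poly_in_pairs = "((nat \<times> nat) \<Rightarrow>\<^sub>0 nat) \<Rightarrow>\<^sub>0 rat"

definition eval_poly ::
  "(rat \<Rightarrow> 'b :: comm_ring_1) \<Rightarrow> (nat \<Rightarrow> nat \<Rightarrow> 'b) \<Rightarrow> poly_in_pairs \<Rightarrow> 'b" where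
  "eval_poly c u P = (\<Sum>m\<in>Poly_Mapping.keys P. c (Poly_Mapping.lookup P m) *
     (\<Prod>(j, k)\<in>Poly_Mapping.keys m. u j k ^ Poly_Mapping.lookup m (j, k)))"

text \<open>
  The expression of an element of \<open>Lambda r\<close> as a polynomial in the power sums \<open>p\<^sub>k(X\<^sub>j)\<close> with
  \<open>1 \<le> j \<le> r\<close> and \<open>k \<ge> 1\<close>; these generate the ring freely, so the polynomial exists and is unique.
\<close>

definition in_power_sums :: "nat \<Rightarrow> series \<Rightarrow> poly_in_pairs" where
  "in_power_sums r f = (SOME P.
     (\<forall>m\<in>Poly_Mapping.keys P. Poly_Mapping.keys m \<subseteq> {1..r} \<times> {1..}) \<and>
     eval_poly const power_sum P = f)"

text \<open>
  The plethystic substitution \<open>p\<^sub>k(X\<^sub>j) \<mapsto> u j k\<close>, with values in Laurent series in \<open>z\<close>. There \<open>z\<close>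
  is the Laurent variable \<open>fls_X\<close>; the variable \<open>Z\<close> does not occur in the coefficients.
\<close>

definition plethysm :: "nat \<Rightarrow> (nat \<Rightarrow> nat \<Rightarrow> series fls) \<Rightarrow> series \<Rightarrow> series fls" where
  "plethysm r u f = eval_poly (\<lambda>c. fls_const (const c)) u (in_power_sums r f)"

text \<open>
  \<open>f(\<dots> | X\<^sub>i + z\<^sup>-\<^sup>1 | X\<^bsub>i+1\<^esub> - z\<^sup>-\<^sup>1 | \<dots>)\<close>. Adding \<open>z\<^sup>-\<^sup>1\<close> as an extra variable to \<open>X\<^sub>i\<close> adds \<open>z\<^sup>-\<^sup>k\<close>
  to \<open>p\<^sub>k(X\<^sub>i)\<close>. The exponent of the letter added to \<open>X\<^sub>i\<close> must be \<open>-1\<close>: with \<open>X\<^sub>i + z\<close> the formula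
  for \<open>D\<^sub>i\<close> below fails already for \<open>f = p\<^sub>1(X\<^sub>i)\<close>, where \<open>D\<^sub>i f = p\<^sub>1(X\<^sub>i) + p\<^sub>1(X\<^bsub>i+1\<^esub>)\<close>
  but \<open>(p\<^sub>1(X\<^sub>i) + z) \<Omega>(z X\<^bsub>i+1\<^esub>)\<close> has constant term \<open>p\<^sub>1(X\<^sub>i)\<close> in \<open>z\<close>.
\<close>

definition shift_alphabets :: "nat \<Rightarrow> nat \<Rightarrow> series \<Rightarrow> series fls" where
  "shift_alphabets r i = plethysm r (\<lambda>j k.
     fls_const (power_sum j k) +
       (if j = i then fls_X_inv ^ k
        else if j = i + 1 then - (fls_X_inv ^ k)
        else 0))"

definition Omega_z :: "nat \<Rightarrow> series fls" where
  "Omega_z i = fps_to_fls (Abs_fps (complete_homogeneous i))"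

end

theory Submission
  imports Defs
begin

text \<open>
  Write \<open>f\<close> as a polynomial in power sums. Adding \<open>z\<close> to \<open>X\<^sub>i\<close> replaces \<open>p\<^sub>k(X\<^sub>i)\<close> by \<open>p\<^sub>k(X\<^sub>i) + z\<^sup>k\<close>,
  and \<open>p\<^sub>k(X\<^bsub>i+1\<^esub>) = p\<^sub>k(X\<^bsub>i+1\<^esub> + z) - z\<^sup>k\<close>; so the specialised \<open>f\<close> is a polynomial \<open>\<Sum>\<^sub>a C\<^sub>a z\<^sup>a\<close> in \<open>z\<close>
  whose coefficients are symmetric in \<open>z\<close> and the letters of \<open>X\<^bsub>i+1\<^esub>\<close>. The operators \<open>\<xi>\<close> are linear
  over such coefficients, and each of them adds one letter to the alphabet of a complete homogeneous
  function: \<open>\<xi>\<^bsub>x,y\<^esub> h\<^sub>a(S + x) = h\<^sub>a(S + x + y)\<close>. Hence they turn \<open>z\<^sup>a = h\<^sub>a(z)\<close> into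
  \<open>h\<^sub>a(z + X\<^bsub>i+1\<^esub>)\<close>, and setting \<open>z = 0\<close> leaves \<open>\<Sum>\<^sub>a C\<^sub>a h\<^sub>a(X\<^bsub>i+1\<^esub>)\<close> with \<open>z\<close> removed from the \<open>C\<^sub>a\<close>.
  On the other side, the plethystic substitution is \<open>\<Sum>\<^sub>a C\<^sub>a z\<^sup>-\<^sup>a\<close> with the same \<open>C\<^sub>a\<close>, and its
  product with \<open>\<Omega>(z X\<^bsub>i+1\<^esub>)\<close> has the same constant term.
\<close>

section \<open>Formal power series and ring homomorphisms\<close>

lemma coeff_zero [simp]: "coeff 0 m = 0"
  by (simp add: zero_mseries_def)

lemma coeff_add [simp]: "coeff (f + g) m = coeff f m + coeff g m"
  by (simp add: plus_mseries_def)

lemma coeff_diff [simp]: "coeff (f - g) m = coeff f m - coeff g m"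
  by (simp add: minus_mseries_def)

lemma coeff_one: "coeff 1 m = (if m = 0 then 1 else 0)"
  by (simp add: one_mseries_def)

lemma coeff_const: "coeff (const c) m = (if m = 0 then c else 0)"
  by (simp add: const_def)

lemma coeff_mult: "coeff (f * g) m = (\<Sum>(a, b)\<in>splits m. coeff f a * coeff g b)"
  by (simp add: times_mseries_def)

lemma coeff_sum: "coeff (sum f A) m = (\<Sum>x\<in>A. coeff (f x) m)"
  by (induction A rule: infinite_finite_induct) auto

lemma keys_add_nat: "Poly_Mapping.keys (a + b) = Poly_Mapping.keys a \<union> Poly_Mapping.keys (b :: 'v \<Rightarrow>\<^sub>0 nat)"
  by (auto simp: in_keys_iff lookup_add)

lemma coeff_variable_mult:
  "coeff (variable x * f) m =
     (if x \<in> Poly_Mapping.keys m then coeff f (m - Poly_Mapping.single x 1) else 0)"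
proof -
  have "coeff (variable x * f) m =
      (\<Sum>(a, b)\<in>splits m. if a = Poly_Mapping.single x 1 then coeff f b else 0)"
    unfolding coeff_mult by (intro sum.cong) (auto simp: variable_def)
  also have "\<dots> = (\<Sum>(a, b)\<in>{p \<in> splits m. fst p = Poly_Mapping.single x 1}. coeff f b)"
    by (intro sum.mono_neutral_cong_right) (auto simp: case_prod_unfold)
  also have "{p \<in> splits m. fst p = Poly_Mapping.single x 1} =
      (if x \<in> Poly_Mapping.keys m
       then {(Poly_Mapping.single x 1, m - Poly_Mapping.single x 1)} else {})"
  proof -
    have "Poly_Mapping.single x 1 + (m - Poly_Mapping.single x 1) = m" if "x \<in> Poly_Mapping.keys m"
      using that
      by (intro poly_mapping_eqI) (auto simp: lookup_add lookup_minus lookup_single in_keys_iff when_def)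
    then show ?thesis
      by (auto simp: splits_def keys_add_nat)
  qed
  finally show ?thesis by simp
qed

text \<open>If x q = y q, the coefficient of q at a monomial equals the one with an x more and a y
  fewer, and vanishes if there is no y; so induct on the exponent of y.\<close>

lemma variable_diff_cancel:
  fixes q :: "('v, 'a :: comm_ring_1) mseries"
  assumes "x \<noteq> y" and "(variable x - variable y) * q = 0"
  shows "q = 0"
proof (rule mseries_eqI)
  fix m :: "'v \<Rightarrow>\<^sub>0 nat"
  have eq: "coeff (variable x * q) m = coeff (variable y * q) m" for m
    using arg_cong[OF assms(2), of "\<lambda>f. coeff f m"] by (simp add: algebra_simps)
  show "coeff q m = coeff 0 m"
  proof (induction "Poly_Mapping.lookup m y" arbitrary: m)
    case 0
    have "y \<notin> Poly_Mapping.keys (m + Poly_Mapping.single x 1)"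
      using 0 assms(1) by (simp add: in_keys_iff lookup_add lookup_single when_def)
    then show ?case
      using eq[of "m + Poly_Mapping.single x 1"] by (simp add: coeff_variable_mult keys_add_nat)
  next
    case (Suc k)
    let ?m = "m + Poly_Mapping.single x 1 - Poly_Mapping.single y 1"
    have "Poly_Mapping.lookup ?m y = k"
      using Suc(2) assms(1) by (simp add: lookup_add lookup_minus lookup_single when_def)
    moreover have "y \<in> Poly_Mapping.keys (m + Poly_Mapping.single x 1)"
      using Suc(2) by (simp add: in_keys_iff lookup_add)
    ultimately show ?case
      using eq[of "m + Poly_Mapping.single x 1"] Suc(1)[of ?m]
      by (simp add: coeff_variable_mult keys_add_nat)
  qed
qed

text \<open>Replaces the quotient in \<open>xi\<close> by an identity without denominators;
  cancelling x - y gives uniqueness.\<close>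

lemma xi_eqI:
  assumes "x \<noteq> y" and "(variable x - variable y) * q = variable x * g - variable y * swap_vars x y g"
  shows "xi x y g = q"
  unfolding xi_def
proof (rule the_equality)
  fix q' assume "(variable x - variable y) * q' = variable x * g - variable y * swap_vars x y g"
  then have "(variable x - variable y) * (q' - q) = 0"
    using assms(2) by (simp add: right_diff_distrib)
  from variable_diff_cancel[OF assms(1) this] show "q' = q" by simp
qed (fact assms(2))

section \<open>Ring homomorphisms: renaming variables, setting them to zero, scalars\<close>

locale ring_homomorphism =
  fixes \<phi> :: "'a :: comm_ring_1 \<Rightarrow> 'b :: comm_ring_1"
  assumes one [simp]: "\<phi> 1 = 1"
    and add [simp]: "\<phi> (x + y) = \<phi> x + \<phi> y"
    and mult [simp]: "\<phi> (x * y) = \<phi> x * \<phi> y"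
begin

lemma zero [simp]: "\<phi> 0 = 0"
  using add[of 0 0] by simp

lemma uminus [simp]: "\<phi> (- x) = - \<phi> x"
  using add[of x "- x"] by (simp add: eq_neg_iff_add_eq_0 add.commute del: add)

lemma power [simp]: "\<phi> (x ^ n) = \<phi> x ^ n"
  by (induction n) auto

lemma sum: "\<phi> (sum f A) = (\<Sum>x\<in>A. \<phi> (f x))"
  by (induction A rule: infinite_finite_induct) auto

lemma prod: "\<phi> (prod f A) = (\<Prod>x\<in>A. \<phi> (f x))"
  by (induction A rule: infinite_finite_induct) auto

lemma eval_poly: "\<phi> (eval_poly c u P) = eval_poly (\<lambda>a. \<phi> (c a)) (\<lambda>j k. \<phi> (u j k)) P"
  by (simp add: eval_poly_def sum prod case_prod_unfold)

lemma map_poly: "ring_homomorphism (map_poly \<phi>)"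
proof
  fix p q :: "'a poly"
  show "map_poly \<phi> (p * q) = map_poly \<phi> p * map_poly \<phi> q"
    by (rule poly_eqI) (simp add: coeff_map_poly Polynomial.coeff_mult sum)
  show "map_poly \<phi> (p + q) = map_poly \<phi> p + map_poly \<phi> q"
    by (rule poly_eqI) (simp add: coeff_map_poly)
qed simp

end

text \<open>Identities between power sums hold in general only for k \<ge> 1, so generators are
  replaced only at the indices that occur in \<open>P\<close>.\<close>

lemma eval_poly_cong:
  assumes "\<And>m. m \<in> Poly_Mapping.keys P \<Longrightarrow> Poly_Mapping.keys m \<subseteq> S"
    and "\<And>j k. (j, k) \<in> S \<Longrightarrow> u j k = v j k"
  shows "eval_poly c u P = eval_poly c v P"
  unfolding eval_poly_def using assms
  by (intro sum.cong refl arg_cong2[of _ _ _ _ "(*)"] prod.cong) (auto, metis subsetD)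

lemma ring_homomorphism_rename:
  assumes "bij \<pi>"
  shows "ring_homomorphism (rename \<pi> :: ('v, 'a :: comm_ring_1) mseries \<Rightarrow> _)"
proof
  note inj = bij_is_inj[OF assms] and inj' = bij_is_inj[OF bij_imp_bij_inv[OF assms]]
  let ?k = "Poly_Mapping.map_key :: ('v \<Rightarrow> 'v) \<Rightarrow> ('v \<Rightarrow>\<^sub>0 nat) \<Rightarrow> _"
  have k1: "?k \<pi> (?k (inv \<pi>) m) = m" for m
    by (rule poly_mapping_eqI) (simp add: map_key.rep_eq inj inj')
  have k2: "?k (inv \<pi>) (?k \<pi> m) = m" for m
    by (rule poly_mapping_eqI) (simp add: map_key.rep_eq inj inj' bij_is_surj[OF assms] surj_f_inv_f)
  have k0: "?k \<pi> m = 0 \<longleftrightarrow> m = 0" for m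
    using k2[of m] by (auto simp: map_key_zero[OF inj] map_key_zero[OF inj'])
  fix f g :: "('v, 'a) mseries"
  show "rename \<pi> 1 = (1 :: ('v, 'a) mseries)"
    by (rule mseries_eqI) (simp add: rename_def coeff_one k0)
  show "rename \<pi> (f + g) = rename \<pi> f + rename \<pi> g"
    by (rule mseries_eqI) (simp add: rename_def)
  show "rename \<pi> (f * g) = rename \<pi> f * rename \<pi> g"
  proof (rule mseries_eqI)
    fix m
    show "coeff (rename \<pi> (f * g)) m = coeff (rename \<pi> f * rename \<pi> g) m"
      unfolding rename_def coeff_MSeries coeff_mult
      by (rule sum.reindex_bij_witness[of _ "map_prod (?k \<pi>) (?k \<pi>)" "map_prod (?k (inv \<pi>)) (?k (inv \<pi>))"])
        (auto simp: splits_def k1 k2 simp flip: map_key_plus[OF inj] map_key_plus[OF inj'])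
  qed
qed

lemma ring_homomorphism_swap_vars:
  "ring_homomorphism (swap_vars x y :: ('v, 'a :: comm_ring_1) mseries \<Rightarrow> _)"
  unfolding swap_vars_def by (intro ring_homomorphism_rename) simp

lemma coeff_set_zero:
  "coeff (set_zero S f) m = (if Poly_Mapping.keys m \<inter> S = {} then coeff f m else 0)"
  by (simp add: set_zero_def)

text \<open>Exponents are nonnegative, so a product of two monomials avoids \<open>S\<close> exactly
  if both factors do.\<close>

lemma ring_homomorphism_set_zero:
  "ring_homomorphism (set_zero S :: ('v, 'a :: comm_ring_1) mseries \<Rightarrow> _)"
proof
  fix f g :: "('v, 'a) mseries"
  show "set_zero S 1 = (1 :: ('v, 'a) mseries)"
    by (rule mseries_eqI) (simp add: coeff_set_zero coeff_one)
  show "set_zero S (f + g) = set_zero S f + set_zero S g"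
    by (rule mseries_eqI) (simp add: coeff_set_zero)
  show "set_zero S (f * g) = set_zero S f * set_zero S g"
  proof (rule mseries_eqI)
    fix m
    have "coeff f a * coeff g b = coeff (set_zero S f) a * coeff (set_zero S g) b"
      if "(a, b) \<in> splits m" "Poly_Mapping.keys m \<inter> S = {}" for a b
      using that by (auto simp: splits_def coeff_set_zero keys_add_nat)
    moreover have "coeff (set_zero S f) a * coeff (set_zero S g) b = 0"
      if "(a, b) \<in> splits m" "Poly_Mapping.keys m \<inter> S \<noteq> {}" for a b
      using that by (auto simp: splits_def coeff_set_zero keys_add_nat)
    ultimately show "coeff (set_zero S (f * g)) m = coeff (set_zero S f * set_zero S g) m"
      unfolding coeff_set_zero[of S "f * g"] coeff_mult
      by (auto intro!: sum.cong sum.neutral simp del: sum.neutral simp: case_prod_unfold)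
  qed
qed

text \<open>Makes the extraction of the constant term a ring homomorphism, which can be pushed into
  polynomial expressions.\<close>

lemma coeff_of_power_0: "coeff_of_power x 0 = set_zero {x}"
  by (intro ext mseries_eqI) (simp add: coeff_of_power_def coeff_set_zero)

lemma ring_homomorphism_const:
  "ring_homomorphism (const :: 'a :: comm_ring_1 \<Rightarrow> ('v, 'a) mseries)"
proof
  fix a b :: 'a
  show "const (a * b) = (const a * const b :: ('v, 'a) mseries)"
  proof (rule mseries_eqI)
    fix m :: "'v \<Rightarrow>\<^sub>0 nat"
    have "coeff (const a * const b) m = (\<Sum>(p, q)\<in>splits m \<inter> {(0, 0)}. a * b)"
      unfolding coeff_mult
      by (intro sum.mono_neutral_cong_right) (auto simp: coeff_const split: if_splits)
    then show "coeff (const (a * b)) m = coeff (const a * const b) m"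
      by (cases "m = 0") (auto simp: splits_def coeff_const)
  qed
qed (auto intro: mseries_eqI simp: coeff_const coeff_one)

lemma rename_const [simp]:
  assumes "bij (\<pi> :: 'v \<Rightarrow> 'v)"
  shows "rename \<pi> (const c) = const c"
proof (rule mseries_eqI)
  fix m :: "'v \<Rightarrow>\<^sub>0 nat"
  have "Poly_Mapping.map_key \<pi> m = 0 \<longleftrightarrow> m = 0"
    using bij_is_surj[OF assms]
    by (simp add: poly_mapping_eq_iff fun_eq_iff map_key.rep_eq bij_is_inj[OF assms]) (metis surj_def)
  then show "coeff (rename \<pi> (const c)) m = coeff (const c) m"
    by (simp add: rename_def coeff_const)
qed

lemma swap_vars_const [simp]: "swap_vars x y (const c) = const c"
  by (simp add: swap_vars_def)

lemma set_zero_const [simp]: "set_zero S (const c) = const c"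
  by (rule mseries_eqI) (simp add: coeff_set_zero coeff_const)


lemma coeff_rename: "coeff (rename \<pi> f) m = coeff f (Poly_Mapping.map_key \<pi> m)"
  by (simp add: rename_def)

section \<open>Power sums and complete homogeneous functions of an alphabet\<close>

text \<open>Covers truncated alphabets and alphabets containing \<open>Z\<close>. The value at k = 0
  is degenerate: 1 for nonempty \<open>S\<close>, 0 for empty \<open>S\<close>.\<close>

definition psum :: "'v set \<Rightarrow> nat \<Rightarrow> ('v, 'a :: comm_ring_1) mseries" where
  "psum S k = MSeries (\<lambda>m. if \<exists>v\<in>S. m = Poly_Mapping.single v k then 1 else 0)"

definition complete :: "'v set \<Rightarrow> nat \<Rightarrow> ('v, 'a :: comm_ring_1) mseries" where
  "complete S n = MSeries (\<lambda>m. if Poly_Mapping.keys m \<subseteq> S \<and> total_degree m = n then 1 else 0)"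

lemma coeff_psum: "coeff (psum S k) m = (if \<exists>v\<in>S. m = Poly_Mapping.single v k then 1 else 0)"
  by (simp add: psum_def)

lemma coeff_complete:
  "coeff (complete S n) m = (if Poly_Mapping.keys m \<subseteq> S \<and> total_degree m = n then 1 else 0)"
  by (simp add: complete_def)

lemma power_sum_eq: "power_sum i = psum (alphabet i)"
  by (intro ext) (simp add: power_sum_def psum_def)

lemma complete_homogeneous_eq: "complete_homogeneous i = complete (alphabet i)"
  by (intro ext) (simp add: complete_homogeneous_def complete_def)

lemma map_key_eq_single_iff:
  assumes "bij \<pi>"
  shows "Poly_Mapping.map_key \<pi> m = Poly_Mapping.single v k \<longleftrightarrow> m = Poly_Mapping.single (\<pi> v) k"
proof
  note inj = bij_is_inj[OF assms]
  assume eq: "Poly_Mapping.map_key \<pi> m = Poly_Mapping.single v k"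
  show "m = Poly_Mapping.single (\<pi> v) k"
  proof (rule poly_mapping_eqI)
    fix w
    obtain u where u: "w = \<pi> u" using bij_is_surj[OF assms] by (metis surjD)
    have "Poly_Mapping.lookup m w = Poly_Mapping.lookup (Poly_Mapping.map_key \<pi> m) u"
      by (simp add: map_key.rep_eq inj u)
    then show "Poly_Mapping.lookup m w = Poly_Mapping.lookup (Poly_Mapping.single (\<pi> v) k) w"
      by (simp add: eq u lookup_single when_def inj_eq[OF inj])
  qed
qed (simp add: map_key_single bij_is_inj[OF assms])

lemma total_degree_map_key:
  assumes "bij \<pi>"
  shows "total_degree (Poly_Mapping.map_key \<pi> m) = total_degree m"
proof -
  note inj = bij_is_inj[OF assms]
  have "Poly_Mapping.keys m = \<pi> ` Poly_Mapping.keys (Poly_Mapping.map_key \<pi> m)"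
    using bij_is_surj[OF assms] by (simp add: keys_map_key[OF inj] surj_image_vimage_eq)
  then show ?thesis
    by (simp add: total_degree_def sum.reindex[OF inj_on_subset[OF inj]] map_key.rep_eq[OF inj])
qed

lemma rename_psum:
  assumes "bij \<pi>"
  shows "rename \<pi> (psum S k) = psum (\<pi> ` S) k"
  by (rule mseries_eqI) (simp add: coeff_rename coeff_psum map_key_eq_single_iff[OF assms])

lemma rename_complete:
  assumes "bij \<pi>"
  shows "rename \<pi> (complete S n) = complete (\<pi> ` S) n"
proof (rule mseries_eqI)
  fix m :: "'a \<Rightarrow>\<^sub>0 nat"
  have "\<pi> -` Poly_Mapping.keys m \<subseteq> S \<longleftrightarrow> Poly_Mapping.keys m \<subseteq> \<pi> ` S"
    using bij_is_inj[OF assms] bij_is_surj[OF assms]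
    by (metis image_mono image_vimage_subset inj_vimage_image_eq surj_image_vimage_eq vimage_mono)
  then show "coeff (rename \<pi> (complete S n)) m = coeff (complete (\<pi> ` S) n) m"
    by (simp add: coeff_rename coeff_complete total_degree_map_key[OF assms]
        keys_map_key[OF bij_is_inj[OF assms]])
qed

lemma swap_vars_psum: "swap_vars x y (psum S k) = psum (transpose x y ` S) k"
  by (simp add: swap_vars_def rename_psum)

lemma swap_vars_complete: "swap_vars x y (complete S n) = complete (transpose x y ` S) n"
  by (simp add: swap_vars_def rename_complete)

lemma set_zero_psum: "1 \<le> k \<Longrightarrow> set_zero T (psum S k) = psum (S - T) k"
  by (rule mseries_eqI) (auto simp: coeff_set_zero coeff_psum split: if_splits)

lemma set_zero_complete: "set_zero T (complete S n) = complete (S - T) n"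
  by (rule mseries_eqI) (auto simp: coeff_set_zero coeff_complete)

lemma single_eq_single_iff:
  "a \<noteq> 0 \<Longrightarrow> Poly_Mapping.single v a = Poly_Mapping.single w b \<longleftrightarrow> v = w \<and> a = b"
  by (metis lookup_single_eq lookup_single_not_eq)

lemma psum_Un: "S \<inter> T = {} \<Longrightarrow> 1 \<le> k \<Longrightarrow> psum (S \<union> T) k = psum S k + psum T k"
  by (rule mseries_eqI) (auto simp: coeff_psum single_eq_single_iff)

lemma total_degree_add: "total_degree (a + b) = total_degree a + total_degree b"
  unfolding total_degree_def
  by (rule setsum_keys_plus_distrib) auto

lemma total_degree_single [simp]: "total_degree (Poly_Mapping.single v k) = k"
  by (simp add: total_degree_def)

lemma add_diff_single:
  assumes "k \<le> Poly_Mapping.lookup m v"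
  shows "Poly_Mapping.single v k + (m - Poly_Mapping.single v k) = (m :: 'v \<Rightarrow>\<^sub>0 nat)"
  using assms by (intro poly_mapping_eqI) (auto simp: lookup_add lookup_minus lookup_single when_def)

lemma variable_power: "variable v ^ k = (psum {v} k :: ('v, 'a :: comm_ring_1) mseries)"
proof (induction k)
  case 0
  show ?case by (rule mseries_eqI) (simp add: coeff_one coeff_psum)
next
  case (Suc k)
  show ?case
  proof (rule mseries_eqI)
    fix m :: "'v \<Rightarrow>\<^sub>0 nat"
    have "v \<in> Poly_Mapping.keys m \<and> m - Poly_Mapping.single v 1 = Poly_Mapping.single v k
        \<longleftrightarrow> m = Poly_Mapping.single v (Suc k)"
    proof
      assume "v \<in> Poly_Mapping.keys m \<and> m - Poly_Mapping.single v 1 = Poly_Mapping.single v k"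
      then show "m = Poly_Mapping.single v (Suc k)"
        using add_diff_single[of 1 m v] by (simp add: in_keys_iff flip: single_add)
    qed (simp flip: single_diff)
    then have "coeff (variable v ^ Suc k :: ('v, 'a) mseries) m =
        (if m = Poly_Mapping.single v (Suc k) then 1 else 0)"
      unfolding power_Suc Suc coeff_variable_mult coeff_psum by (metis (lifting) singletonD singletonI)
    then show "coeff (variable v ^ Suc k :: ('v, 'a) mseries) m = coeff (psum {v} (Suc k)) m"
      by (simp add: coeff_psum)
  qed
qed

lemma complete_singleton: "complete {v} n = variable v ^ n"
proof (rule mseries_eqI)
  fix m :: "'a \<Rightarrow>\<^sub>0 nat"
  have "Poly_Mapping.keys m \<subseteq> {v} \<and> total_degree m = n \<longleftrightarrow> m = Poly_Mapping.single v n"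
  proof
    assume m: "Poly_Mapping.keys m \<subseteq> {v} \<and> total_degree m = n"
    then have "Poly_Mapping.lookup m v = n"
      by (auto simp: total_degree_def subset_singleton_iff)
    with m show "m = Poly_Mapping.single v n"
      by (intro poly_mapping_eqI) (auto simp: lookup_single when_def in_keys_iff)
  qed auto
  then show "coeff (complete {v} n) m = coeff (variable v ^ n) m"
    by (simp add: coeff_complete variable_power coeff_psum)
qed

lemma coeff_variable_mult_complete:
  assumes "x \<in> S"
  shows "coeff (variable x * complete S n) m =
    (if x \<in> Poly_Mapping.keys m \<and> Poly_Mapping.keys m \<subseteq> S \<and> total_degree m = Suc n then 1 else 0)"
proof (cases "x \<in> Poly_Mapping.keys m")
  case True
  then obtain m' where m: "m = Poly_Mapping.single x 1 + m'"
    using add_diff_single[of 1 m x] by (metis in_keys_iff less_one not_less)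
  show ?thesis
    using assms by (simp add: m coeff_variable_mult coeff_complete keys_add_nat total_degree_add)
qed (simp add: coeff_variable_mult)

text \<open>Coefficientwise count: on the left the monomials of degree n + 1 containing both x and y
  cancel, which leaves those with x but not y, minus those with y but not x.\<close>

lemma complete_insert_two:
  assumes "x \<notin> S" "y \<notin> S" "x \<noteq> y"
  shows "(variable x - variable y) * complete (insert x (insert y S)) n =
         variable x * complete (insert x S) n - variable y * complete (insert y S) n"
  by (rule mseries_eqI) (use assms in \<open>auto simp: left_diff_distrib coeff_variable_mult_complete\<close>)

section \<open>The operators \<open>\<xi>\<close> and \<open>D\<^sub>i\<close>\<close>

text \<open>Umbral evaluation: the linear map that replaces the a-th power of the indeterminate by
  \<open>h a\<close>.\<close>

definition umbral :: "(nat \<Rightarrow> 'a :: comm_ring_1) \<Rightarrow> 'a poly \<Rightarrow> 'a" where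
  "umbral h p = (\<Sum>a\<le>degree p. poly.coeff p a * h a)"

lemma umbral_power: "umbral (\<lambda>a. x ^ a) p = poly p x"
  by (simp add: umbral_def poly_altdef)

text \<open>Together: \<open>\<phi>\<close> moves into the coefficients and into \<open>h\<close>.
  Both sums run to \<open>degree p\<close>, because coefficients mapped to 0 can lower the degree of
  \<open>map_poly \<phi> p\<close>.\<close>

lemma (in ring_homomorphism) umbral:
  "\<phi> (umbral h p) = (\<Sum>a\<le>degree p. \<phi> (poly.coeff p a) * \<phi> (h a))"
  "umbral g (map_poly \<phi> p) = (\<Sum>a\<le>degree p. \<phi> (poly.coeff p a) * g a)"
proof -
  show "\<phi> (umbral h p) = (\<Sum>a\<le>degree p. \<phi> (poly.coeff p a) * \<phi> (h a))"
    by (simp add: umbral_def sum)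
  show "umbral g (map_poly \<phi> p) = (\<Sum>a\<le>degree p. \<phi> (poly.coeff p a) * g a)"
    unfolding umbral_def
  proof (intro sum.mono_neutral_cong_left ballI)
    fix a assume "a \<in> {..degree p} - {..degree (map_poly \<phi> p)}"
    then show "\<phi> (poly.coeff p a) * g a = 0"
      using coeff_eq_0[of "map_poly \<phi> p" a] by (simp add: coeff_map_poly)
  qed (auto simp: coeff_map_poly intro: le_trans[OF _ map_poly_degree_leq])
qed

text \<open>Coefficients fixed by the swap behave as constants for \<open>xi x y\<close>, so only
  the complete functions change, by \<open>complete_insert_two\<close>.\<close>

lemma xi_umbral:
  assumes "x \<notin> S" "y \<notin> S" "x \<noteq> y"
    and "\<And>a. swap_vars x y (poly.coeff p a) = poly.coeff p a"
  shows "xi x y (umbral (complete (insert x S)) p) = umbral (complete (insert x (insert y S))) p"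
proof (rule xi_eqI[OF assms(3)])
  interpret swap: ring_homomorphism "swap_vars x y :: series \<Rightarrow> _"
    by (rule ring_homomorphism_swap_vars)
  have "transpose x y ` S = S" 
    using assms by (auto simp: transpose_def image_iff)
  then have "swap_vars x y (umbral (complete (insert x S)) p) = umbral (complete (insert y S)) p"
    by (simp add: umbral_def swap.sum swap_vars_complete assms(4))
  then show "(variable x - variable y) * umbral (complete (insert x (insert y S))) p =
      variable x * umbral (complete (insert x S)) p -
      variable y * swap_vars x y (umbral (complete (insert x S)) p)"
    using complete_insert_two[OF assms(1-3), where 'b = rat]
    by (simp add: umbral_def sum_distrib_left mult.left_commute sum_subtractf right_diff_distrib
        flip: sum_subtractf)
qed

section \<open>Adjoining the letters of a finite alphabet one by one\<close>

definition truncated_alphabet :: "nat \<Rightarrow> nat \<Rightarrow> var set" where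
  "truncated_alphabet n j = {X j k |k. 1 \<le> k \<and> k \<le> n}"

text \<open>Iterates \<open>xi_umbral\<close> from the one-letter alphabet z, where h_a(z) = z^a:
  each operator uses a letter already present and adjoins the next. All swaps involved fix the
  coefficients.\<close>

lemma fold_xi_umbral:
  assumes "1 \<le> n"
    and "\<And>x y a. x \<in> insert Z (truncated_alphabet n j) \<Longrightarrow> y \<in> insert Z (truncated_alphabet n j) \<Longrightarrow>
      swap_vars x y (poly.coeff p a) = poly.coeff p a"
  shows "fold (\<lambda>k. xi (X j k) (X j (k + 1))) [1..<n] (xi Z (X j 1) (poly p (variable Z))) =
    umbral (complete (insert Z (truncated_alphabet n j))) p"
  using assms
proof (induction n rule: dec_induct)
  case base
  have "truncated_alphabet 1 j = {X j 1}" by (auto simp: truncated_alphabet_def)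
  then show ?case
    using xi_umbral[of Z "{}" "X j 1" p] base
    by (simp add: umbral_def poly_altdef complete_singleton)
next
  case (step n)
  \<comment> \<open>\<open>xi_umbral\<close> needs the letter \<open>X j n\<close> set apart from
    the rest, hence the index n - 1.\<close>
  let ?S = "insert Z (truncated_alphabet (n - 1) j)"
  have sub: "insert Z (truncated_alphabet n j) \<subseteq> insert Z (truncated_alphabet (Suc n) j)"
    by (auto simp: truncated_alphabet_def)
  have eqs: "insert Z (truncated_alphabet n j) = insert (X j n) ?S"
    "insert Z (truncated_alphabet (Suc n) j) = insert (X j n) (insert (X j (Suc n)) ?S)"
    using step(1) by (auto simp: truncated_alphabet_def)
  have "xi (X j n) (X j (n + 1)) (umbral (complete (insert (X j n) ?S)) p) =
      umbral (complete (insert (X j n) (insert (X j (n + 1)) ?S))) p"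
    by (rule xi_umbral) (use step in \<open>auto simp: truncated_alphabet_def\<close>)
  moreover have "fold (\<lambda>k. xi (X j k) (X j (k + 1))) [1..<n] (xi Z (X j 1) (poly p (variable Z))) =
    umbral (complete (insert Z (truncated_alphabet n j))) p"
    using step(3,4) sub by blast
  ultimately show ?case
    using step(1) by (simp add: eqs)
qed

text \<open>The letter with index n i + 1 is the first that truncation kills; after the swap
  \<open>Z\<close> stands in its place and survives. For j \<noteq> i no letter moves.\<close>

lemma transpose_image_truncated_alphabet:
  "transpose Z (X i (n i + 1)) ` alphabet j - {X j k |j k. n j < k} =
     truncated_alphabet (n j) j \<union> (if j = i then {Z} else {})"
  by (auto simp: truncated_alphabet_def alphabet_def transpose_def image_iff split: if_splits)

lemma ring_homomorphism_comp:
  assumes "ring_homomorphism f" "ring_homomorphism g"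
  shows "ring_homomorphism (\<lambda>x. g (f x))"
  using assms by (simp add: ring_homomorphism_def)

lemma ring_homomorphism_specialise: "ring_homomorphism (specialise i n)"
  unfolding specialise_def
  by (rule ring_homomorphism_comp[OF ring_homomorphism_swap_vars ring_homomorphism_set_zero])

lemma specialise_const: "specialise i n (const c) = const c"
  by (simp add: specialise_def)

lemma specialise_power_sum:
  assumes "1 \<le> k"
  shows "specialise i n (power_sum j k) =
    psum (truncated_alphabet (n j) j \<union> (if j = i then {Z} else {})) k"
  unfolding specialise_def power_sum_eq swap_vars_psum set_zero_psum[OF assms]
    transpose_image_truncated_alphabet ..

definition shift_sign :: "nat \<Rightarrow> nat \<Rightarrow> 'a :: comm_ring_1" where
  "shift_sign i j = (if j = i then 1 else if j = i + 1 then - 1 else 0)"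

text \<open>
  The expression \<open>P\<close> with the letter \<open>t\<close> added to \<open>X\<^sub>i\<close> and removed from \<open>X\<^bsub>i+1\<^esub>\<close>, as a polynomial in \<open>t\<close>.
\<close>

definition shift_poly :: "nat \<Rightarrow> (nat \<Rightarrow> nat \<Rightarrow> series) \<Rightarrow> poly_in_pairs \<Rightarrow> series poly" where
  "shift_poly i u =
     eval_poly (\<lambda>c. [:const c:]) (\<lambda>j k. [:u j k:] + shift_sign i j * monom 1 k)"

lemma (in ring_homomorphism) shift_sign: "\<phi> (shift_sign i j) = shift_sign i j"
  by (simp add: shift_sign_def)

lemma map_poly_shift_poly:
  assumes "ring_homomorphism \<phi>" and "\<And>c. \<phi> (const c) = const c"
  shows "map_poly \<phi> (shift_poly i u P) = shift_poly i (\<lambda>j k. \<phi> (u j k)) P"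
proof -
  interpret ring_homomorphism \<phi> by fact
  interpret p: ring_homomorphism "map_poly \<phi>" by (rule map_poly)
  show ?thesis
    by (simp add: shift_poly_def p.eval_poly p.shift_sign map_poly_pCons map_poly_monom assms(2))
qed

lemma shift_poly_cong:
  assumes "\<And>m. m \<in> Poly_Mapping.keys P \<Longrightarrow> Poly_Mapping.keys m \<subseteq> S"
    and "\<And>j k. (j, k) \<in> S \<Longrightarrow> u j k = v j k"
  shows "shift_poly i u P = shift_poly i v P"
  unfolding shift_poly_def by (rule eval_poly_cong[OF assms(1)]) (simp_all add: assms(2))

text \<open>Serves both sides of the formula: specialisation takes t to be
  \<open>variable Z\<close>, the plethystic substitution takes it to be the inverse of the Laurent
  variable.\<close>

lemma poly_map_shift_poly:
  assumes "ring_homomorphism \<phi>"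
  shows "poly (map_poly \<phi> (shift_poly i u P)) t =
    eval_poly (\<lambda>c. \<phi> (const c)) (\<lambda>j k. \<phi> (u j k) + shift_sign i j * t ^ k) P"
proof -
  interpret ring_homomorphism \<phi> by fact
  interpret p: ring_homomorphism "map_poly \<phi>" by (rule map_poly)
  interpret ev: ring_homomorphism "\<lambda>p. poly p t" by standard auto
  show ?thesis
    by (simp add: shift_poly_def p.eval_poly ev.eval_poly p.shift_sign ev.shift_sign map_poly_pCons
        map_poly_monom poly_monom)
qed

lemma ring_homomorphism_id: "ring_homomorphism (\<lambda>x. x)"
  by standard auto

section \<open>Values of D_i on polynomials in power sums\<close>

context
  fixes r i :: nat and P :: poly_in_pairs
  assumes keys_P: "\<And>m. m \<in> Poly_Mapping.keys P \<Longrightarrow> Poly_Mapping.keys m \<subseteq> {1..r} \<times> {1..}"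
begin

text \<open>Rests on p_k(Y) = p_k(Y + z) - z^k: \<open>Z\<close> is put into alphabet i + 1 and
  compensated by the sign -1, which makes the coefficients symmetric in z and that alphabet.\<close>

lemma specialise_eval_poly:
  "specialise i n (eval_poly const power_sum P) =
     poly (shift_poly i (\<lambda>j. psum (truncated_alphabet (n j) j \<union> (if j = i + 1 then {Z} else {}))) P)
       (variable Z)" (is "_ = poly (shift_poly i ?u P) _")
proof -
  interpret ring_homomorphism "specialise i n" by (rule ring_homomorphism_specialise)
  have Z: "Z \<notin> truncated_alphabet m j" for m j
    by (auto simp: truncated_alphabet_def)
  have eq: "specialise i n (power_sum j k) = ?u j k + shift_sign i j * variable Z ^ k"
    if "(j, k) \<in> {1..r} \<times> {1..}" for j k
    using that Z psum_Un[of "truncated_alphabet (n j) j" "{Z}" k]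
    by (auto simp: specialise_power_sum shift_sign_def variable_power)
  have "specialise i n (eval_poly const power_sum P) =
      eval_poly const (\<lambda>j k. ?u j k + shift_sign i j * variable Z ^ k) P"
    unfolding eval_poly specialise_const by (rule eval_poly_cong[OF keys_P]) (assumption, rule eq)
  also have "\<dots> = poly (shift_poly i ?u P) (variable Z)"
    using poly_map_shift_poly[OF ring_homomorphism_id, of i ?u P "variable Z"] by simp
  finally show ?thesis .
qed

text \<open>The operators turn powers of z into complete functions of z and alphabet i + 1; removing
  z then leaves the truncation of the expression in full alphabets. One letter is required because
  \<open>D_fin\<close> always adjoins \<open>X (i + 1) 1\<close>.\<close>

lemma D_fin_eval_poly:
  assumes "1 \<le> n (i + 1)"
  shows "D_fin i n (eval_poly const power_sum P) =
    set_zero {X j k |j k. n j < k}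
      (umbral (complete_homogeneous (i + 1)) (shift_poly i power_sum P))"
proof -
  let ?Y = "\<lambda>j. truncated_alphabet (n j) j" and ?S = "{X j k |j k. n j < k}"
  let ?p = "shift_poly i (\<lambda>j. psum (?Y j \<union> (if j = i + 1 then {Z} else {}))) P"
  interpret Z: ring_homomorphism "set_zero {Z} :: series \<Rightarrow> _"
    by (rule ring_homomorphism_set_zero)
  interpret S: ring_homomorphism "set_zero ?S :: series \<Rightarrow> _"
    by (rule ring_homomorphism_set_zero)
  have Z: "Z \<notin> ?Y j" for j
    by (auto simp: truncated_alphabet_def)
  have sym: "swap_vars x y (poly.coeff ?p a) = poly.coeff ?p a"
    if "x \<in> insert Z (?Y (i + 1))" "y \<in> insert Z (?Y (i + 1))" for x y a
  proof -
    interpret swap: ring_homomorphism "swap_vars x y :: series \<Rightarrow> _"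
      by (rule ring_homomorphism_swap_vars)
    \<comment> \<open>Only alphabet i + 1, enlarged by \<open>Z\<close>, can contain x or y, and it
      contains both; so the swap fixes all alphabets.\<close>
    have "x \<in> ?Y j \<union> (if j = i + 1 then {Z} else {}) \<longleftrightarrow> y \<in> ?Y j \<union> (if j = i + 1 then {Z} else {})" for j
      using that by (auto simp: truncated_alphabet_def)
    then have "map_poly (swap_vars x y) ?p = ?p"
      by (subst map_poly_shift_poly[OF ring_homomorphism_swap_vars])
        (simp_all only: swap_vars_psum swap_vars_const transpose_image_eq)
    then show ?thesis
      using coeff_map_poly[of "swap_vars x y" ?p a] by simp
  qed
  \<comment> \<open>Acts on the coefficients alone: \<open>Z\<close> leaves alphabet i + 1, while
    the indeterminate of \<open>?p\<close> is independent of \<open>Z\<close>.\<close>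
  have "map_poly (set_zero {Z}) ?p =
      shift_poly i (\<lambda>j k. set_zero {Z} (psum (?Y j \<union> (if j = i + 1 then {Z} else {})) k)) P"
    by (rule map_poly_shift_poly[OF ring_homomorphism_set_zero]) simp
  also have "\<dots> = shift_poly i (\<lambda>j. psum (?Y j)) P"
  proof (rule shift_poly_cong[OF keys_P])
    fix j k assume "(j, k) \<in> {1..r} \<times> {1 :: nat..}"
    moreover have "?Y j \<union> (if j = i + 1 then {Z} else {}) - {Z} = ?Y j"
      using Z[of j] by auto
    ultimately show "set_zero {Z} (psum (?Y j \<union> (if j = i + 1 then {Z} else {})) k) = psum (?Y j) k"
      by (subst set_zero_psum) auto
  qed
  finally have pZ: "map_poly (set_zero {Z}) ?p = shift_poly i (\<lambda>j. psum (?Y j)) P" .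
  have Y: "alphabet j - ?S = ?Y j" for j
    by (auto simp: alphabet_def truncated_alphabet_def)
  have "map_poly (set_zero ?S) (shift_poly i power_sum P) =
      shift_poly i (\<lambda>j k. set_zero ?S (power_sum j k)) P"
    by (rule map_poly_shift_poly[OF ring_homomorphism_set_zero]) simp
  also have "\<dots> = shift_poly i (\<lambda>j. psum (?Y j)) P"
    by (rule shift_poly_cong[OF keys_P]) (simp_all add: power_sum_eq set_zero_psum Y)
  finally have pS: "map_poly (set_zero ?S) (shift_poly i power_sum P) =
      shift_poly i (\<lambda>j. psum (?Y j)) P" .
  have "D_fin i n (eval_poly const power_sum P) =
      set_zero {Z} (umbral (complete (insert Z (?Y (i + 1)))) ?p)"
    unfolding D_fin_def specialise_eval_poly coeff_of_power_0
    using fold_xi_umbral[OF assms, of "i + 1" ?p] sym by simp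
  also have "\<dots> = umbral (complete (?Y (i + 1))) (map_poly (set_zero {Z}) ?p)"
    using Z[of "i + 1"] by (simp add: Z.umbral set_zero_complete)
  also have "\<dots> = umbral (complete (?Y (i + 1))) (map_poly (set_zero ?S) (shift_poly i power_sum P))"
    by (simp only: pZ pS)
  also have "\<dots> = set_zero ?S (umbral (complete_homogeneous (i + 1)) (shift_poly i power_sum P))"
    by (simp add: S.umbral complete_homogeneous_eq set_zero_complete Y)
  finally show ?thesis .
qed

text \<open>Each \<open>D_fin\<close> is a truncation of one fixed series, so a coefficient is
  stable once all n_j reach the indices of the letters in its monomial.\<close>

lemma D_eval_poly:
  assumes "1 \<le> i" "i \<le> r - 1"
  shows "D r i (eval_poly const power_sum P) =
    umbral (complete_homogeneous (i + 1)) (shift_poly i power_sum P)" (is "_ = ?G")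
  unfolding D_def
proof (rule the_equality)
  \<comment> \<open>Everything outside the alphabets 1 to r. The limit does not control n_j for
    other j, so \<open>?G\<close> must be shown free of their letters.\<close>
  define W where "W = - (\<Union>j\<in>{1..r}. alphabet j)"
  interpret W: ring_homomorphism "set_zero W :: series \<Rightarrow> _"
    by (rule ring_homomorphism_set_zero)
  have W: "alphabet j - W = alphabet j" if "j \<in> {1..r}" for j
    using that by (auto simp: W_def)
  have "map_poly (set_zero W) (shift_poly i power_sum P) =
      shift_poly i (\<lambda>j k. set_zero W (power_sum j k)) P"
    by (rule map_poly_shift_poly[OF ring_homomorphism_set_zero]) simp
  also have "\<dots> = shift_poly i power_sum P"
    by (rule shift_poly_cong[OF keys_P]) (auto simp: power_sum_eq set_zero_psum W)
  finally have "map_poly (set_zero W) (shift_poly i power_sum P) = shift_poly i power_sum P" .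
  \<comment> \<open>The bounds on i put i + 1 in the range 1 to r, so the complete functions avoid
    \<open>W\<close> as well.\<close>
  then have G: "set_zero W ?G = ?G"
    using assms W.umbral(1)[of "complete_homogeneous (i + 1)" "shift_poly i power_sum P"]
      W.umbral(2)[of "complete_homogeneous (i + 1)" "shift_poly i power_sum P"]
    by (simp add: complete_homogeneous_eq set_zero_complete W)
  show lim: "coeffwise_limit r (\<lambda>n. D_fin i n (eval_poly const power_sum P)) ?G"
    unfolding coeffwise_limit_def
  proof
    fix m :: "var \<Rightarrow>\<^sub>0 nat"
    \<comment> \<open>The sum bounds the second index of every letter of m; \<open>Suc\<close> makes
      \<open>N\<close> at least 1, as \<open>D_fin_eval_poly\<close> requires.\<close>
    define N where "N = Suc (\<Sum>v\<in>Poly_Mapping.keys m. case v of Z \<Rightarrow> 0 | X j k \<Rightarrow> k)"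
    have N: "k \<le> N" if "X j k \<in> Poly_Mapping.keys m" for j k
      using member_le_sum[OF that, of "\<lambda>v. case v of Z \<Rightarrow> 0 | X j k \<Rightarrow> k"] by (simp add: N_def)
    have "coeff (D_fin i n (eval_poly const power_sum P)) m = coeff ?G m"
      if n: "\<forall>j\<in>{1..r}. N \<le> n j" for n
    proof -
      have "N \<le> n (i + 1)" using n assms by simp
      then have "1 \<le> n (i + 1)" by (simp add: N_def)
      moreover have "coeff ?G m = 0" if "X j k \<in> Poly_Mapping.keys m" "n j < k" for j k
      proof -
        have "j \<notin> {1..r}" using n N[OF that(1)] that(2) by (meson le_trans not_le)
        then have "X j k \<in> W" by (auto simp: W_def alphabet_def)
        then show ?thesis
          using that(1) by (subst G[symmetric]) (auto simp: coeff_set_zero)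
      qed
      ultimately show ?thesis
        by (auto simp: D_fin_eval_poly coeff_set_zero)
    qed
    then show "\<exists>N. \<forall>n. (\<forall>j\<in>{1..r}. N \<le> n j) \<longrightarrow>
        coeff (D_fin i n (eval_poly const power_sum P)) m = coeff ?G m"
      by blast
  qed
  fix L assume L: "coeffwise_limit r (\<lambda>n. D_fin i n (eval_poly const power_sum P)) L"
  show "L = ?G"
  proof (rule mseries_eqI)
    fix m
    obtain N N' where N:
        "\<And>n. (\<forall>j\<in>{1..r}. N \<le> n j) \<Longrightarrow> coeff (D_fin i n (eval_poly const power_sum P)) m = coeff L m"
        "\<And>n. (\<forall>j\<in>{1..r}. N' \<le> n j) \<Longrightarrow> coeff (D_fin i n (eval_poly const power_sum P)) m = coeff ?G m"
      using L lim unfolding coeffwise_limit_def by meson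
    \<comment> \<open>A constant family beyond both bounds is a common point of comparison for the
      two limits.\<close>
    show "coeff L m = coeff ?G m"
      using N(1)[of "\<lambda>_. max N N'"] N(2)[of "\<lambda>_. max N N'"] by simp
  qed
qed

end

section \<open>Constant term of the plethystic side\<close>

lemma ring_homomorphism_fls_const: "ring_homomorphism (fls_const :: 'a :: comm_ring_1 \<Rightarrow> _)"
  by standard (auto simp: fls_plus_const)

text \<open>The substituted expression is a polynomial in z^-1, and multiplying z^-a by \<Omega>
  brings h_a to the constant term.\<close>

lemma fls_nth_shift:
  "fls_nth (eval_poly (\<lambda>c. fls_const (const c)) (\<lambda>j k. fls_const (power_sum j k) +
       (if j = i then fls_X_inv ^ k else if j = i + 1 then - (fls_X_inv ^ k) else 0)) P *
     Omega_z (i + 1)) 0 =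
   umbral (complete_homogeneous (i + 1)) (shift_poly i power_sum P)"
proof -
  interpret ring_homomorphism "fls_const :: series \<Rightarrow> _"
    by (rule ring_homomorphism_fls_const)
  let ?p = "shift_poly i power_sum P"
  have "(\<lambda>j k. fls_const (power_sum j k) +
       (if j = i then fls_X_inv ^ k else if j = i + 1 then - (fls_X_inv ^ k) else 0)) =
     (\<lambda>j k. fls_const (power_sum j k) + shift_sign i j * fls_X_inv ^ k)"
    by (intro ext) (simp add: shift_sign_def)
  then have "eval_poly (\<lambda>c. fls_const (const c)) (\<lambda>j k. fls_const (power_sum j k) +
       (if j = i then fls_X_inv ^ k else if j = i + 1 then - (fls_X_inv ^ k) else 0)) P =
      umbral (\<lambda>a. fls_X_inv ^ a) (map_poly fls_const ?p)"
    by (simp only: poly_map_shift_poly[OF ring_homomorphism_fls_const] umbral_power)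
  also have "\<dots> = (\<Sum>a\<le>degree ?p. fls_const (poly.coeff ?p a) * fls_X_inv ^ a)"
    by (rule umbral)
  finally have eq: "eval_poly (\<lambda>c. fls_const (const c)) (\<lambda>j k. fls_const (power_sum j k) +
       (if j = i then fls_X_inv ^ k else if j = i + 1 then - (fls_X_inv ^ k) else 0)) P =
      (\<Sum>a\<le>degree ?p. fls_const (poly.coeff ?p a) * fls_X_inv ^ a)" .
  have nth: "fls_nth (fls_const c * fls_X_inv ^ a * Omega_z (i + 1)) 0 =
      c * complete_homogeneous (i + 1) a" for c a
    by (simp add: mult.assoc Omega_z_def fls_X_inv_power_times_conv_shift(1) del: fls_const_mult_const)
  show ?thesis
    unfolding eq sum_distrib_right fls_nth_sum nth umbral_def ..
qed

section \<open>Power sums generate the symmetric functions\<close>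

definition monomial :: "(nat \<Rightarrow> nat \<Rightarrow> 'b :: comm_ring_1) \<Rightarrow> ((nat \<times> nat) \<Rightarrow>\<^sub>0 nat) \<Rightarrow> 'b" where
  "monomial u m = (\<Prod>(j, k)\<in>Poly_Mapping.keys m. u j k ^ Poly_Mapping.lookup m (j, k))"

lemma monomial_add: "monomial u (a + b) = monomial u a * monomial u b"
proof -
  have "monomial u c = (\<Prod>(j, k)\<in>Poly_Mapping.keys (a + b). u j k ^ Poly_Mapping.lookup c (j, k))"
    if "Poly_Mapping.keys c \<subseteq> Poly_Mapping.keys (a + b)" for c
    unfolding monomial_def using that
    by (intro prod.mono_neutral_left) (auto simp: in_keys_iff)
  from this[of a] this[of b] show ?thesis
    by (simp add: keys_add_nat monomial_def lookup_add power_add case_prod_unfold prod.distrib)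
qed

text \<open>For R = {1..r} the condition on \<open>P\<close> is the one in
  \<open>in_power_sums\<close>, so membership provides a witness for the choice made there.\<close>

definition power_sum_ring :: "nat set \<Rightarrow> series set" where
  "power_sum_ring R =
    {eval_poly const power_sum P |P. \<forall>m\<in>Poly_Mapping.keys P. Poly_Mapping.keys m \<subseteq> R \<times> {1..}}"

lemma power_sum_ring_mono: "R \<subseteq> R' \<Longrightarrow> power_sum_ring R \<subseteq> power_sum_ring R'"
  unfolding power_sum_ring_def by blast

lemma power_sum_ring_add:
  assumes "f \<in> power_sum_ring R" "g \<in> power_sum_ring R"
  shows "f + g \<in> power_sum_ring R"
proof -
  interpret ring_homomorphism "const :: rat \<Rightarrow> series" by (rule ring_homomorphism_const)
  obtain P Q where P: "f = eval_poly const power_sum P"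
      "\<forall>m\<in>Poly_Mapping.keys P. Poly_Mapping.keys m \<subseteq> R \<times> {1..}"
    and Q: "g = eval_poly const power_sum Q"
      "\<forall>m\<in>Poly_Mapping.keys Q. Poly_Mapping.keys m \<subseteq> R \<times> {1..}"
    using assms unfolding power_sum_ring_def by blast
  have "f + g = eval_poly const power_sum (P + Q)"
    unfolding P Q eval_poly_def
    by (rule setsum_keys_plus_distrib[symmetric]) (simp_all add: distrib_right)
  moreover have "\<forall>m\<in>Poly_Mapping.keys (P + Q). Poly_Mapping.keys m \<subseteq> R \<times> {1..}"
    using keys_add[of P Q] P(2) Q(2) by blast
  ultimately show ?thesis
    unfolding power_sum_ring_def by blast
qed

lemma power_sum_ring_monomial:
  assumes "Poly_Mapping.keys m \<subseteq> R \<times> {1..}"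
  shows "const c * monomial power_sum m \<in> power_sum_ring R"
proof -
  interpret ring_homomorphism "const :: rat \<Rightarrow> series" by (rule ring_homomorphism_const)
  have "const c * monomial power_sum m = eval_poly const power_sum (Poly_Mapping.single m c)"
    by (simp add: eval_poly_def monomial_def)
  then show ?thesis
    using assms unfolding power_sum_ring_def by (force split: if_splits)
qed

lemma power_sum_ring_const: "const c \<in> power_sum_ring R"
  using power_sum_ring_monomial[of 0 R c] by (simp add: monomial_def)

lemma power_sum_ring_power_sum:
  assumes "i \<in> R" "1 \<le> k"
  shows "power_sum i k \<in> power_sum_ring R"
  using power_sum_ring_monomial[of "Poly_Mapping.single (i, k) 1" R 1] assms
  by (simp add: monomial_def ring_homomorphism.one[OF ring_homomorphism_const])

lemma power_sum_ring_sum: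
  "(\<And>x. x \<in> A \<Longrightarrow> f x \<in> power_sum_ring R) \<Longrightarrow> sum f A \<in> power_sum_ring R"
  using power_sum_ring_const[of 0 R]
  by (induction A rule: infinite_finite_induct)
    (auto intro: power_sum_ring_add simp: ring_homomorphism.zero[OF ring_homomorphism_const])

lemma power_sum_ring_mult:
  assumes "f \<in> power_sum_ring R" "g \<in> power_sum_ring R"
  shows "f * g \<in> power_sum_ring R"
proof -
  interpret ring_homomorphism "const :: rat \<Rightarrow> series" by (rule ring_homomorphism_const)
  obtain P Q where P: "f = eval_poly const power_sum P"
      "\<forall>m\<in>Poly_Mapping.keys P. Poly_Mapping.keys m \<subseteq> R \<times> {1..}"
    and Q: "g = eval_poly const power_sum Q"
      "\<forall>m\<in>Poly_Mapping.keys Q. Poly_Mapping.keys m \<subseteq> R \<times> {1..}"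
    using assms unfolding power_sum_ring_def by blast
  have "f * g = (\<Sum>a\<in>Poly_Mapping.keys P. \<Sum>b\<in>Poly_Mapping.keys Q.
      const (Poly_Mapping.lookup P a * Poly_Mapping.lookup Q b) * monomial power_sum (a + b))"
    unfolding P Q eval_poly_def sum_product
    by (simp add: monomial_add mult_ac flip: monomial_def)
  moreover have "\<dots> \<in> power_sum_ring R"
    using P(2) Q(2)
    by (intro power_sum_ring_sum power_sum_ring_monomial) (auto simp: keys_add_nat)
  ultimately show ?thesis by simp
qed

lemma power_sum_ring_prod:
  "(\<And>x. x \<in> A \<Longrightarrow> f x \<in> power_sum_ring R) \<Longrightarrow> prod f A \<in> power_sum_ring R"
  using power_sum_ring_const[of 1 R]
  by (induction A rule: infinite_finite_induct)
    (auto intro: power_sum_ring_mult simp: ring_homomorphism.one[OF ring_homomorphism_const])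

section \<open>Coefficients of power sum products and types of monomials\<close>

lemma coeff_const_mult:
  fixes f :: "('v, 'a :: comm_ring_1) mseries"
  shows "coeff (const c * f) m = c * coeff f m"
proof -
  have "coeff (const c * f) m = (\<Sum>p\<in>{(0, m)}. coeff (const c :: ('v, 'a) mseries) (fst p) * coeff f (snd p))"
    unfolding coeff_mult case_prod_unfold
    by (rule sum.mono_neutral_right[OF finite_splits])
      (auto simp: coeff_const splits_def split: if_splits)
  then show ?thesis by (simp add: coeff_const)
qed

text \<open>The partition that is the type of a monomial, with the nonzero exponents as
  parts.\<close>

definition exponents :: "('v \<Rightarrow>\<^sub>0 nat) \<Rightarrow> nat multiset" where
  "exponents m = image_mset (Poly_Mapping.lookup m) (mset_set (Poly_Mapping.keys m))"

definition power_sum_prod :: "nat \<Rightarrow> nat multiset \<Rightarrow> series" where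
  "power_sum_prod i M = (\<Prod>k\<in>#M. power_sum i k)"

lemma power_sum_prod_simps [simp]:
  "power_sum_prod i {#} = 1"
  "power_sum_prod i (add_mset k M) = power_sum i k * power_sum_prod i M"
  by (simp_all add: power_sum_prod_def)

lemma size_exponents [simp]: "size (exponents m) = card (Poly_Mapping.keys m)"
  by (simp add: exponents_def)

lemma exponents_add_single:
  assumes "v \<notin> Poly_Mapping.keys m" "k \<noteq> 0"
  shows "exponents (Poly_Mapping.single v k + m) = add_mset k (exponents m)"
proof -
  have "Poly_Mapping.lookup (Poly_Mapping.single v k + m) v = k"
    using assms by (simp add: lookup_add in_keys_iff)
  moreover have "image_mset (Poly_Mapping.lookup (Poly_Mapping.single v k + m))
      (mset_set (Poly_Mapping.keys m)) =
      image_mset (Poly_Mapping.lookup m) (mset_set (Poly_Mapping.keys m))"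
    using assms by (intro image_mset_cong) (auto simp: lookup_add lookup_single when_def)
  ultimately show ?thesis
    using assms by (simp add: exponents_def keys_add_nat)
qed

lemma coeff_power_sum_mult_nonzero:
  assumes "coeff (power_sum i k * f) m \<noteq> 0"
  obtains v b where "v \<in> alphabet i" "m = Poly_Mapping.single v k + b" "coeff f b \<noteq> 0"
proof -
  have "\<exists>p\<in>splits m. coeff (power_sum i k) (fst p) * coeff f (snd p) \<noteq> 0"
    using assms unfolding coeff_mult case_prod_unfold by (meson sum.neutral)
  then show ?thesis
    using that by (fastforce simp: splits_def power_sum_def split: if_splits)
qed

lemma coeff_power_sum_prod_nonneg: "0 \<le> coeff (power_sum_prod i M) m"
proof (induction M arbitrary: m)
  case (add k M)
  then show ?case
    by (auto simp: coeff_mult power_sum_def intro!: sum_nonneg mult_nonneg_nonneg)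
qed (simp add: coeff_one)

text \<open>A monomial of the product takes one power of a letter from each factor. Coinciding
  letters merge, so at most \<open>size M\<close> letters occur, with equality only when all are
  distinct and the exponents are the parts of \<open>M\<close>. This is the triangularity of
  p_\<lambda> against the monomial basis.\<close>

lemma coeff_power_sum_prod_nonzero:
  assumes "0 \<notin># M" "coeff (power_sum_prod i M) m \<noteq> 0"
  shows "Poly_Mapping.keys m \<subseteq> alphabet i" "total_degree m = sum_mset M"
    "card (Poly_Mapping.keys m) \<le> size M" "card (Poly_Mapping.keys m) = size M \<Longrightarrow> exponents m = M"
proof -
  have "Poly_Mapping.keys m \<subseteq> alphabet i \<and> total_degree m = sum_mset M \<and>
    card (Poly_Mapping.keys m) \<le> size M \<and> (card (Poly_Mapping.keys m) = size M \<longrightarrow> exponents m = M)"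
    using assms
  proof (induction M arbitrary: m)
    case empty
    then show ?case by (simp add: coeff_one total_degree_def exponents_def split: if_splits)
  next
    case (add k M)
    then obtain v b where vb: "v \<in> alphabet i" "m = Poly_Mapping.single v k + b"
        "coeff (power_sum_prod i M) b \<noteq> 0"
      by (auto elim: coeff_power_sum_mult_nonzero)
    have IH: "Poly_Mapping.keys b \<subseteq> alphabet i" "total_degree b = sum_mset M"
      "card (Poly_Mapping.keys b) \<le> size M" "card (Poly_Mapping.keys b) = size M \<longrightarrow> exponents b = M"
      using add.IH[OF _ vb(3)] add.prems by auto
    have "k \<noteq> 0" using add.prems by auto
    then show ?case
      using IH vb(1) exponents_add_single[of v b k]
      by (cases "v \<in> Poly_Mapping.keys b")
        (auto simp: vb(2) keys_add_nat total_degree_add insert_absorb)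
  qed
  then show "Poly_Mapping.keys m \<subseteq> alphabet i" "total_degree m = sum_mset M"
    "card (Poly_Mapping.keys m) \<le> size M" "card (Poly_Mapping.keys m) = size M \<Longrightarrow> exponents m = M"
    by auto
qed

text \<open>Giving each factor the letter with its exponent produces m itself, and all other
  contributions are nonnegative. So the triangular system has a nonzero diagonal.\<close>

lemma coeff_power_sum_prod_exponents_pos:
  assumes "Poly_Mapping.keys m \<subseteq> alphabet i"
  shows "0 < coeff (power_sum_prod i (exponents m)) m"
  using assms
proof (induction "card (Poly_Mapping.keys m)" arbitrary: m)
  case 0
  then show ?case by (simp add: exponents_def coeff_one)
next
  case (Suc n)
  then obtain v where v: "v \<in> Poly_Mapping.keys m" by (metis card_eq_0_iff ex_in_conv nat.distinct(1))
  define k where "k = Poly_Mapping.lookup m v"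
  define b where "b = m - Poly_Mapping.single v k"
  have k: "k \<noteq> 0" using v by (simp add: k_def in_keys_iff)
  have m: "m = Poly_Mapping.single v k + b"
    using add_diff_single[of k m v] by (simp add: b_def k_def)
  have vb: "v \<notin> Poly_Mapping.keys b"
    by (simp add: b_def k_def in_keys_iff lookup_minus)
  have "0 < coeff (power_sum_prod i (exponents b)) b"
    using Suc k vb by (intro Suc(1)) (auto simp: m keys_add_nat)
  also have "\<dots> = (\<Sum>(a, c)\<in>{(Poly_Mapping.single v k, b)}.
      coeff (power_sum i k) a * coeff (power_sum_prod i (exponents b)) c)"
    using v Suc.prems by (auto simp: power_sum_def)
  also have "\<dots> \<le> coeff (power_sum i k * power_sum_prod i (exponents b)) m"
    unfolding coeff_mult
    by (intro sum_mono2 finite_splits)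
      (auto simp: m splits_def power_sum_def coeff_power_sum_prod_nonneg)
  finally show ?case
    using exponents_add_single[OF vb k] by (simp add: m)
qed

section \<open>Symmetry of coefficients and closure properties of \<open>Sym i\<close>\<close>

lemma SymD:
  assumes "f \<in> Sym i"
  shows "coeff f m \<noteq> 0 \<Longrightarrow> Poly_Mapping.keys m \<subseteq> alphabet i"
    and "\<pi> permutes alphabet i \<Longrightarrow> rename \<pi> f = f"
    and "\<exists>d. \<forall>m. coeff f m \<noteq> 0 \<longrightarrow> total_degree m \<le> d"
  using assms unfolding Sym_def by blast+

text \<open>Monomials of one type differ by a permutation of finitely many letters, which the
  identity extends to the alphabet.\<close>

lemma Sym_coeff_eq:
  assumes "f \<in> Sym i" "Poly_Mapping.keys m \<subseteq> alphabet i" "Poly_Mapping.keys m' \<subseteq> alphabet i"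
    and "exponents m = exponents m'"
  shows "coeff f m = coeff f m'"
proof -
  define A where "A = Poly_Mapping.keys m \<union> Poly_Mapping.keys m'"
  have A: "finite A" "A \<subseteq> alphabet i" using assms(2,3) by (auto simp: A_def)
  \<comment> \<open>Both supports are padded with zeros to their union; having equal size they
    receive equally many zeros, so the multisets over \<open>A\<close> agree.\<close>
  have ext: "image_mset (Poly_Mapping.lookup c) (mset_set A) =
      exponents c + replicate_mset (card A - card (Poly_Mapping.keys c)) 0"
    if "Poly_Mapping.keys c \<subseteq> A" for c :: "var \<Rightarrow>\<^sub>0 nat"
  proof -
    have "mset_set A = mset_set (Poly_Mapping.keys c) + mset_set (A - Poly_Mapping.keys c)"
      using that A(1) by (metis Diff_disjoint Diff_partition finite_Diff finite_keys mset_set_Union)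
    moreover have "image_mset (Poly_Mapping.lookup c) (mset_set (A - Poly_Mapping.keys c)) =
        image_mset (\<lambda>_. 0) (mset_set (A - Poly_Mapping.keys c))"
      using A(1) by (intro image_mset_cong) (simp add: in_keys_iff)
    ultimately show ?thesis
      using that by (simp add: exponents_def image_mset_const_eq card_Diff_subset)
  qed
  have "card (Poly_Mapping.keys m) = card (Poly_Mapping.keys m')"
    using assms(4) by (metis size_exponents)
  then have "image_mset (Poly_Mapping.lookup m) (mset_set A) =
      image_mset (Poly_Mapping.lookup m') (mset_set A)"
    using ext[of m] ext[of m'] by (simp only: assms(4) A_def Un_upper1 Un_upper2)
  from image_mset_eq_implies_permutes[OF A(1) this] obtain \<pi>
    where \<pi>: "\<pi> permutes A" "\<forall>x\<in>A. Poly_Mapping.lookup m x = Poly_Mapping.lookup m' (\<pi> x)"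
    by blast
  have "Poly_Mapping.map_key \<pi> m' = m"
  proof (rule poly_mapping_eqI)
    fix v
    have "Poly_Mapping.lookup m' (\<pi> v) = Poly_Mapping.lookup m v"
    proof (cases "v \<in> A")
      case False
      then show ?thesis
        using permutes_not_in[OF \<pi>(1), of v] by (simp add: A_def in_keys_iff)
    qed (simp add: \<pi>(2))
    then show "Poly_Mapping.lookup (Poly_Mapping.map_key \<pi> m') v = Poly_Mapping.lookup m v"
      by (simp add: map_key.rep_eq[OF permutes_inj[OF \<pi>(1)]])
  qed
  then have "coeff (rename \<pi> f) m' = coeff f m"
    by (simp only: coeff_rename)
  then show ?thesis
    by (simp only: SymD(2)[OF assms(1) permutes_subset[OF \<pi>(1) A(2)]])
qed

lemma power_sum_prod_in_Sym:
  assumes "0 \<notin># M"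
  shows "power_sum_prod i M \<in> Sym i"
proof -
  have "rename \<pi> (power_sum_prod i M) = power_sum_prod i M" if "\<pi> permutes alphabet i" for \<pi>
  proof -
    have bij: "bij \<pi>" by (rule permutes_bij[OF that])
    interpret ring_homomorphism "rename \<pi> :: series \<Rightarrow> _"
      by (rule ring_homomorphism_rename[OF bij])
    show ?thesis
      by (induction M) (simp_all add: power_sum_eq rename_psum[OF bij] permutes_image[OF that])
  qed
  then show ?thesis
    unfolding Sym_def mem_Collect_eq
  proof (intro conjI allI impI exI[of _ "sum_mset M"])
    fix m assume "coeff (power_sum_prod i M) m \<noteq> 0"
    note nz = coeff_power_sum_prod_nonzero(1,2)[OF assms this]
    show "Poly_Mapping.keys m \<subseteq> alphabet i" by (fact nz(1))
    show "total_degree m \<le> sum_mset M" by (simp only: nz(2))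
  qed
qed

lemma Sym_const_mult:
  assumes "f \<in> Sym i"
  shows "const c * f \<in> Sym i"
proof -
  have "rename \<pi> (const c * f) = const c * f" if "\<pi> permutes alphabet i" for \<pi>
    using SymD(2)[OF assms that] permutes_bij[OF that]
    by (simp add: ring_homomorphism.mult[OF ring_homomorphism_rename])
  then show ?thesis
    using SymD(1,3)[OF assms] by (auto simp: Sym_def coeff_const_mult)
qed

lemma Sym_add:
  assumes "f \<in> Sym i" "g \<in> Sym i"
  shows "f + g \<in> Sym i"
proof -
  obtain d e where de: "\<And>m. coeff f m \<noteq> 0 \<Longrightarrow> total_degree m \<le> d"
    "\<And>m. coeff g m \<noteq> 0 \<Longrightarrow> total_degree m \<le> e"
    using SymD(3)[OF assms(1)] SymD(3)[OF assms(2)] by blast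
  have nz: "coeff f m \<noteq> 0 \<or> coeff g m \<noteq> 0" if "coeff (f + g) m \<noteq> 0" for m
    using that by auto
  have "total_degree m \<le> max d e" if "coeff (f + g) m \<noteq> 0" for m
    using nz[OF that] de[of m] by (auto simp: le_max_iff_disj)
  moreover have "Poly_Mapping.keys m \<subseteq> alphabet i" if "coeff (f + g) m \<noteq> 0" for m
    using nz[OF that] SymD(1)[OF assms(1)] SymD(1)[OF assms(2)] by blast
  moreover have "rename \<pi> (f + g) = f + g" if "\<pi> permutes alphabet i" for \<pi>
    using SymD(2)[OF assms(1) that] SymD(2)[OF assms(2) that] permutes_bij[OF that]
    by (simp add: ring_homomorphism.add[OF ring_homomorphism_rename])
  ultimately show ?thesis
    unfolding Sym_def by blast
qed

lemma Sym_sum: "(\<And>x. x \<in> A \<Longrightarrow> f x \<in> Sym i) \<Longrightarrow> sum f A \<in> Sym i"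
proof (induction A rule: infinite_finite_induct)
  case (insert x A)
  then show ?case by (simp add: Sym_add)
qed (auto simp: Sym_def rename_def intro: mseries_eqI)

lemma power_sum_prod_in_power_sum_ring:
  assumes "0 \<notin># M"
  shows "power_sum_prod i M \<in> power_sum_ring {i}"
  using assms
proof (induction M)
  case empty
  then show ?case
    using power_sum_ring_const[of 1] by (simp add: ring_homomorphism.one[OF ring_homomorphism_const])
next
  case (add k M)
  then show ?case
    by (auto intro!: power_sum_ring_mult power_sum_ring_power_sum)
qed

lemma zero_notin_exponents: "0 \<notin># exponents m"
  by (auto simp: exponents_def in_keys_iff)

text \<open>
  Induction on the number of variables in a monomial: among monomials with at least \<open>size M\<close>
  variables, only those with exponents \<open>M\<close> occur in \<open>power_sum_prod i M\<close>, so the terms of \<open>f\<close> with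
  the most variables can be cancelled by multiples of such products.
\<close>

lemma Sym_subset_power_sum_ring_aux:
  assumes "f \<in> Sym i" "\<And>m. coeff f m \<noteq> 0 \<Longrightarrow> card (Poly_Mapping.keys m) < l"
  shows "f \<in> power_sum_ring {i}"
  using assms
proof (induction l arbitrary: f)
  case 0
  then have "f = const 0" by (intro mseries_eqI) (auto simp: coeff_const)
  then show ?case by (simp add: power_sum_ring_const)
next
  case (Suc l)
  let ?p = "power_sum_prod i"
  define B where "B = {m. coeff f m \<noteq> 0 \<and> card (Poly_Mapping.keys m) = l}"
  \<comment> \<open>Any monomial of the given type in \<open>B\<close>; by symmetry the quotient
    \<open>c M\<close> does not depend on the choice, and its denominator is positive.\<close>
  define rep where "rep = inv_into B exponents"
  define c where "c M = coeff f (rep M) / coeff (?p M) (rep M)" for M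
  define s where "s = (\<Sum>M\<in>exponents ` B. const (c M) * ?p M)"
  obtain d where d: "\<And>m. coeff f m \<noteq> 0 \<Longrightarrow> total_degree m \<le> d"
    using SymD(3)[OF Suc.prems(1)] by blast
  \<comment> \<open>\<open>B\<close> may be infinite, but bounded degree leaves finitely many types
    with l parts.\<close>
  have "exponents m \<in> multisets_of_size {..d} l" if "m \<in> B" for m
  proof -
    have "Poly_Mapping.lookup m v \<le> d" if "v \<in> Poly_Mapping.keys m" for v
      using member_le_sum[OF that, of "Poly_Mapping.lookup m"] d[of m] \<open>m \<in> B\<close>
      by (simp add: total_degree_def B_def)
    then show ?thesis
      using that by (auto simp: multisets_of_size_def B_def) (auto simp: exponents_def)
  qed
  then have fin: "finite (exponents ` B)"
    by (meson finite_atMost finite_multisets_of_size finite_subset image_subsetI)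
  have nz: "0 \<notin># M" if "M \<in> exponents ` B" for M
    using that zero_notin_exponents by blast
  have s: "s \<in> Sym i" "s \<in> power_sum_ring {i}"
    unfolding s_def using nz
    by (auto intro!: Sym_sum Sym_const_mult power_sum_prod_in_Sym power_sum_ring_sum
        power_sum_ring_mult power_sum_ring_const power_sum_prod_in_power_sum_ring)
  have coeff_s: "coeff s m = (\<Sum>M\<in>exponents ` B. c M * coeff (?p M) m)" for m
    by (simp add: s_def coeff_sum coeff_const_mult)
  have "card (Poly_Mapping.keys m) < l" if "coeff (f - s) m \<noteq> 0" for m
  proof (rule ccontr)
    assume card: "\<not> card (Poly_Mapping.keys m) < l"
    \<comment> \<open>Here \<open>M\<close> has size l and m has at least l letters, so a nonzero
      coefficient would force exactly l letters and type \<open>M\<close>.\<close>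
    have zero: "coeff (?p M) m = 0" if "M \<in> exponents ` B" "M \<noteq> exponents m" for M
      using coeff_power_sum_prod_nonzero(3,4)[OF nz[OF that(1)], of i m] that card
      by (force simp: B_def)
    have "coeff f m = coeff s m"
    proof (cases "exponents m \<in> exponents ` B")
      case True
      define m' where "m' = rep (exponents m)"
      have m': "m' \<in> B" "exponents m' = exponents m"
        using True unfolding m'_def rep_def by (auto intro: inv_into_into f_inv_into_f)
      have k': "Poly_Mapping.keys m' \<subseteq> alphabet i"
        using m'(1) SymD(1)[OF Suc.prems(1)] by (auto simp: B_def)
      have "coeff s m = c (exponents m) * coeff (?p (exponents m)) m"
        unfolding coeff_s using fin True zero by (subst sum.remove[OF _ True]) auto
      also have "\<dots> = coeff f m"
      proof (cases "Poly_Mapping.keys m \<subseteq> alphabet i")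
        case True
        have "coeff (?p (exponents m)) m = coeff (?p (exponents m)) m'"
          using Sym_coeff_eq[OF power_sum_prod_in_Sym[OF zero_notin_exponents] True k'] m'(2) by simp
        moreover have "coeff f m = coeff f m'"
          using Sym_coeff_eq[OF Suc.prems(1) True k'] m'(2) by simp
        moreover have "coeff (?p (exponents m)) m' \<noteq> 0"
          using coeff_power_sum_prod_exponents_pos[OF k'] m'(2) by simp
        ultimately show ?thesis
          by (simp add: c_def flip: m'_def)
      next
        case False
        then have "coeff f m = 0" "coeff (?p (exponents m)) m = 0"
          using SymD(1)[OF Suc.prems(1)] SymD(1)[OF power_sum_prod_in_Sym[OF zero_notin_exponents]]
          by blast+
        then show ?thesis by simp
      qed
      finally show ?thesis by simp
    next
      case False
      then have "coeff s m = 0"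
        unfolding coeff_s using zero by (intro sum.neutral) (metis mult_zero_right)
      \<comment> \<open>More than l letters is excluded by assumption; with exactly l letters a
        nonzero coefficient would put m into \<open>B\<close>.\<close>
      moreover have "coeff f m = 0"
        using False card Suc.prems(2)[of m] by (force simp: B_def)
      ultimately show ?thesis by simp
    qed
    then show False using that by simp
  qed
  moreover have diff: "f - s = f + const (- 1) * s"
    by (rule mseries_eqI) (simp add: coeff_const_mult)
  moreover have "f + const (- 1) * s \<in> Sym i"
    by (intro Sym_add Sym_const_mult Suc.prems(1) s(1))
  ultimately have "f - s \<in> power_sum_ring {i}"
    by (metis Suc.IH)
  then have "(f - s) + s \<in> power_sum_ring {i}"
    by (rule power_sum_ring_add[OF _ s(2)])
  then show ?case by simp
qed

text \<open>Each letter contributes at least 1 to the degree, so bounded degree bounds the number of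
  letters and starts the induction.\<close>

lemma Sym_subset_power_sum_ring: "Sym i \<subseteq> power_sum_ring {i}"
proof
  fix f assume f: "f \<in> Sym i"
  then obtain d where d: "\<And>m. coeff f m \<noteq> 0 \<Longrightarrow> total_degree m \<le> d"
    using SymD(3) by blast
  have le: "card (Poly_Mapping.keys m) \<le> total_degree m" for m :: "var \<Rightarrow>\<^sub>0 nat"
    unfolding total_degree_def card_eq_sum by (rule sum_mono) (simp add: in_keys_iff)
  have "card (Poly_Mapping.keys m) < Suc d" if "coeff f m \<noteq> 0" for m
    using le[of m] d[OF that] by linarith
  then show "f \<in> power_sum_ring {i}"
    by (rule Sym_subset_power_sum_ring_aux[OF f])
qed

lemma Lambda_subset_power_sum_ring: "Lambda r \<subseteq> power_sum_ring {1..r}"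
proof
  fix f assume "f \<in> Lambda r"
  then obtain N :: nat and g where f: "f = (\<Sum>k<N. \<Prod>i=1..r. g k i)"
      and g: "\<And>k i. k < N \<Longrightarrow> i \<in> {1..r} \<Longrightarrow> g k i \<in> Sym i"
    unfolding Lambda_def by blast
  have "g k i \<in> power_sum_ring {1..r}" if "k < N" "i \<in> {1..r}" for k i
    using g[OF that] Sym_subset_power_sum_ring[of i] power_sum_ring_mono[of "{i}" "{1..r}"] that(2)
    by blast
  then show "f \<in> power_sum_ring {1..r}"
    unfolding f by (intro power_sum_ring_sum power_sum_ring_prod) auto
qed

theorem mainTheorem5:
  fixes r i :: nat and f :: series
  assumes "1 \<le> i" and "i \<le> r - 1" and "f \<in> Lambda r"
  shows "D r i f = fls_nth (shift_alphabets r i f * Omega_z (i + 1)) 0"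
proof -
  define P where "P = in_power_sums r f"
  \<comment> \<open>A representation exists, so the one chosen by \<open>in_power_sums\<close> meets
    its specification; both sides are then computed from this single \<open>P\<close>.\<close>
  have "\<exists>P. (\<forall>m\<in>Poly_Mapping.keys P. Poly_Mapping.keys m \<subseteq> {1..r} \<times> {1..}) \<and>
      eval_poly const power_sum P = f"
    using assms(3) Lambda_subset_power_sum_ring unfolding power_sum_ring_def by blast
  then have P: "\<forall>m\<in>Poly_Mapping.keys P. Poly_Mapping.keys m \<subseteq> {1..r} \<times> {1..}"
      "eval_poly const power_sum P = f"
    unfolding P_def in_power_sums_def by (rule someI2_ex, blast)+
  have "D r i f = umbral (complete_homogeneous (i + 1)) (shift_poly i power_sum P)"
    using D_eval_poly[of P r i] P assms(1,2) by blast
  also have "\<dots> = fls_nth (shift_alphabets r i f * Omega_z (i + 1)) 0"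
    unfolding shift_alphabets_def plethysm_def P_def[symmetric] by (rule fls_nth_shift[symmetric])
  finally show ?thesis .
qed

end
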